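(* Let $d\ge2$. There exist (one-sided) shifts of finite type $X$ and $Y$ such that $X$ and $Y$ are topologically conjugate but the corresponding hom tree-shifts on the $d$-tree satisfy $h(\mathcal{T}_X)\neq h(\mathcal{T}_Y)$.
   Context: $\mathbb{N}=\{1,2,\dots\}$. A shift space over a finite alphabet $\mathcal{A}$ is a set $X\subseteq\mathcal{A}^{\mathbb{N}}$ consisting of all sequences that avoid every word from some set $\mathcal{F}$ of finite words over $\mathcal{A}$; it is a shift of finite type (SFT) if $\mathcal{F}$ can be taken finite. $\mathcal{A}(X)$ denotes the alphabet of $X$ and $B_n(X)=\{x_1\cdots x_n:x\in X\}$. Shift spaces $X$ and $Y$ are topologically conjugate ($X\cong Y$) if there is a one-to-one correspondence (bijection) $\phi:X\to Y$ induced by a block map $\Phi:B_n(X)\to\mathcal{A}(Y)$ for some $n\in\mathbb{N}$, i.e. $(\phi(x))_i=\Phi(x_i\cdots x_{i+n-1})$ for all $x \in X$, $i\in\mathbb{N}$. Let $\Sigma=\{0,1,\dots,d-1\}$, $\Sigma^*=\bigcup_{n\ge0}\Sigma^n$ the set of all finite words over $\Sigma$ (with empty word $\epsilon$), and $\Delta_n=\bigcup_{i=0}^n\Sigma^i$. A labeled tree is a function $t:\Sigma^*\to\mathcal{A}$, $w\mapsto t_w$. An $n$-block is a function $u:\Delta_n\to\mathcal{A}$; it appears in $t$ if there is $s\in\Sigma^*$ with $t_{sw}=u_w$ for all $w\in\Delta_n$. A chain is a sequence $\mathbf{s}=(s_i)_{i\in\mathbb{N}}$ in $\Sigma^*$ with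 $s_1=\epsilon$ and $s_{i+1}\in s_i\Sigma$ for all $i\ge1$; put $(\pi_{\mathbf{s}}t)_i=t_{s_i}$. The hom tree-shift of a shift space $X\subseteq\mathcal{A}^{\mathbb{N}}$ is $\mathcal{T}_X=\{t\in\mathcal{A}^{\Sigma^*}:\pi_{\mathbf{s}}(t)\in X\text{ for every chain }\mathbf{s}\}$. $B_n(\mathcal{T}_X)$ is the set of $n$-blocks appearing in elements of $\mathcal{T}_X$, and the topological entropy is $h(\mathcal{T}_X)=\lim_{n\to\infty}\frac{\log|B_n(\mathcal{T}_X)|}{|\Delta_n|}$ (the limit is known to exist). *)

theory Defs
  imports Complex_Main "HOL-Library.FuncSet"
begin

text \<open>Sequences indexed by the positive integers are represented as functions on \<^typ>\<open>nat\<close>, with the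
  index shifted by one, and finite words as lists.\<close>

definition occurs_in :: "'a list \<Rightarrow> (nat \<Rightarrow> 'a) \<Rightarrow> bool" where
  "occurs_in w x \<longleftrightarrow> (\<exists>i. map x [i..<i + length w] = w)"

definition shift_avoiding :: "'a set \<Rightarrow> 'a list set \<Rightarrow> (nat \<Rightarrow> 'a) set" where
  "shift_avoiding A F = {x. (\<forall>i. x i \<in> A) \<and> (\<forall>w\<in>F. \<not> occurs_in w x)}"

definition is_SFT :: "'a set \<Rightarrow> (nat \<Rightarrow> 'a) set \<Rightarrow> bool" where
  "is_SFT A X \<longleftrightarrow> finite A \<and> (\<exists>F. finite F \<and> F \<subseteq> lists A \<and> X = shift_avoiding A F)"

text \<open>The alphabet of \<open>X\<close> is read as the set of symbols that occur in \<open>X\<close>. Replacing it by a larger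
  ambient alphabet changes neither of the notions below that use it: a block map inducing a map into
  \<open>Y\<close> only takes values occurring in \<open>Y\<close>, and every node of a tree lies on a chain (if \<open>d > 0\<close>).\<close>

definition alphabet :: "(nat \<Rightarrow> 'a) set \<Rightarrow> 'a set" where
  "alphabet X = (\<Union>x\<in>X. range x)"

definition blocks :: "nat \<Rightarrow> (nat \<Rightarrow> 'a) set \<Rightarrow> 'a list set" where
  "blocks n X = {map x [0..<n] | x. x \<in> X}"

definition conjugate :: "(nat \<Rightarrow> 'a) set \<Rightarrow> (nat \<Rightarrow> 'b) set \<Rightarrow> bool" where
  "conjugate X Y \<longleftrightarrow>
     (\<exists>n \<Phi> \<phi>. n \<ge> 1 \<and> \<Phi> \<in> blocks n X \<rightarrow> alphabet Y \<and> bij_betw \<phi> X Y \<and>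
        (\<forall>x\<in>X. \<forall>i. \<phi> x i = \<Phi> (map x [i..<i + n])))"

abbreviation tree_nodes :: "nat \<Rightarrow> nat list set" where
  "tree_nodes d \<equiv> lists {0..<d}"

definition Delta :: "nat \<Rightarrow> nat \<Rightarrow> nat list set" where
  "Delta d n = {w \<in> tree_nodes d. length w \<le> n}"

definition chain :: "nat \<Rightarrow> (nat \<Rightarrow> nat list) \<Rightarrow> bool" where
  "chain d s \<longleftrightarrow> s 0 = [] \<and> (\<forall>i. \<exists>a<d. s (Suc i) = s i @ [a])"

text \<open>Labeled trees and blocks are extensional functions, so that distinct elements differ on
  \<^term>\<open>tree_nodes d\<close> and \<^term>\<open>Delta d n\<close>, respectively.\<close>

definition hom_tree_shift :: "nat \<Rightarrow> (nat \<Rightarrow> 'a) set \<Rightarrow> (nat list \<Rightarrow> 'a) set" where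
  "hom_tree_shift d X =
     {t \<in> tree_nodes d \<rightarrow>\<^sub>E alphabet X. \<forall>s. chain d s \<longrightarrow> (\<lambda>i. t (s i)) \<in> X}"

definition appears_in :: "nat \<Rightarrow> nat \<Rightarrow> (nat list \<Rightarrow> 'a) \<Rightarrow> (nat list \<Rightarrow> 'a) \<Rightarrow> bool" where
  "appears_in d n u t \<longleftrightarrow> (\<exists>s\<in>tree_nodes d. \<forall>w\<in>Delta d n. t (s @ w) = u w)"

definition tree_blocks :: "nat \<Rightarrow> nat \<Rightarrow> (nat list \<Rightarrow> 'a) set \<Rightarrow> (nat list \<Rightarrow> 'a) set" where
  "tree_blocks d n T = {u \<in> extensional (Delta d n). \<exists>t\<in>T. appears_in d n u t}"

text \<open>For \<open>T = {}\<close> this is \<open>0\<close> rather than minus infinity, since \<open>ln 0 = 0\<close>; the hom tree-shift of a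
  nonempty shift space is nonempty.\<close>

definition tree_entropy :: "nat \<Rightarrow> (nat list \<Rightarrow> 'a) set \<Rightarrow> real" where
  "tree_entropy d T = lim (\<lambda>n. ln (real (card (tree_blocks d n T))) / real (card (Delta d n)))"

end

theory Submission
  imports Defs
begin

text \<open>
  Passing from a shift to a conjugate one by splitting a symbol according to its successor forces
  all children of a node labelled by a split symbol into the same class of successors. On a tree
  this restricts the children, but it also gives more labels to choose from at the last level, and
  on the \<open>d\<close>-tree the last level carries a positive proportion of all nodes. If only some of the symbols
  are split, the two effects need not cancel.

  Take for \<open>X\<close> the full shift on \<open>{0, 1}\<close>, whose hom tree-shift is the full tree-shift of entropy
  \<open>ln 2\<close>. In \<open>Y\<close>, the symbol \<open>0\<close> of \<open>X\<close> is split into \<open>0\<close> (next symbol of \<open>X\<close> is \<open>0\<close>) and \<open>1\<close> (next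
  symbol of \<open>X\<close> is \<open>1\<close>), while the symbol \<open>1\<close> of \<open>X\<close> is called \<open>2\<close> and left unsplit. So \<open>Y\<close> is the
  Markov shift with transitions from \<open>0\<close> to \<open>0, 1\<close>, from \<open>1\<close> to \<open>2\<close>, and from \<open>2\<close> to everything.

  The blocks of the hom tree-shift of a Markov shift are exactly the labelings of \<open>\<Delta>\<^sub>n\<close> along whose
  edges all transitions are allowed (\<open>tree_blocks_markov_shift\<close>), since such a labeling extends
  downwards for ever. Such a block consists of a root symbol and \<open>d\<close> independent blocks of smaller
  height whose roots may follow it (\<open>card_markov_blocks_root\<close>). For \<open>Y\<close>, if \<open>T\<^sub>n\<close> counts all
  blocks and \<open>C\<^sub>n\<close> those with root \<open>2\<close>, this gives
  \<open>T\<^sub>n\<^sub>+\<^sub>1 = (T\<^sub>n - C\<^sub>n)^d + C\<^sub>n^d + T\<^sub>n^d \<ge> \<kappa> T\<^sub>n^d\<close> with \<open>\<kappa> = 1 + 2 / 2^d\<close>, by the power mean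
  inequality. For \<open>X\<close> the corresponding factor is \<open>2\<close>, which is larger than \<open>\<kappa>\<close>, but \<open>Y\<close> starts from \<open>T\<^sub>0 = 3\<close>
  rather than \<open>2\<close>. Iterating, the entropy of \<open>Y\<close> is at least \<open>((d - 1) ln 3 + ln \<kappa>) / d\<close>, and
  this exceeds \<open>ln 2\<close> because \<open>3^(d-1) \<kappa> = 3^(d-1) + (3/2)^(d-1) \<ge> 2 (9/4)^(d-1) > 2^d\<close>, again by
  the power mean inequality.
\<close>

section \<open>Markov shifts\<close>

definition markov_shift :: "'a set \<Rightarrow> ('a \<Rightarrow> 'a \<Rightarrow> bool) \<Rightarrow> (nat \<Rightarrow> 'a) set" where
  "markov_shift A E = {x. (\<forall>i. x i \<in> A) \<and> (\<forall>i. E (x i) (x (Suc i)))}"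

lemma occurs_in_two: "occurs_in [a, b] x \<longleftrightarrow> (\<exists>i. x i = a \<and> x (Suc i) = b)"
  by (auto simp: occurs_in_def upt_rec)

lemma is_SFT_markov_shift:
  assumes "finite A"
  shows "is_SFT A (markov_shift A E)"
proof -
  define F where "F = (\<lambda>(a, b). [a, b]) ` {(a, b) \<in> A \<times> A. \<not> E a b}"
  have "finite {(a, b) \<in> A \<times> A. \<not> E a b}"
    by (rule finite_subset[OF _ finite_cartesian_product[OF assms assms]]) auto
  then have "finite F"
    by (simp add: F_def)
  moreover have "F \<subseteq> lists A"
    by (auto simp: F_def)
  moreover have "markov_shift A E = shift_avoiding A F"
    unfolding markov_shift_def shift_avoiding_def F_def by (auto simp: occurs_in_two)
  ultimately show ?thesis
    using assms by (auto simp: is_SFT_def)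
qed

lemma alphabet_markov_shift:
  assumes serial: "\<And>a. a \<in> A \<Longrightarrow> \<exists>b\<in>A. E a b"
  shows "alphabet (markov_shift A E) = A"
proof
  show "alphabet (markov_shift A E) \<subseteq> A"
    by (auto simp: alphabet_def markov_shift_def)
  obtain f where f: "\<And>a. a \<in> A \<Longrightarrow> f a \<in> A \<and> E a (f a)"
    using serial by metis
  show "A \<subseteq> alphabet (markov_shift A E)"
  proof
    fix a assume "a \<in> A"
    then have "(f ^^ i) a \<in> A" for i
      by (induction i) (auto simp: f)
    then have "(\<lambda>i. (f ^^ i) a) \<in> markov_shift A E"
      by (auto simp: markov_shift_def f)
    moreover have "a \<in> range (\<lambda>i. (f ^^ i) a)"
      by (rule range_eqI[of _ _ 0]) simp
    ultimately show "a \<in> alphabet (markov_shift A E)"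
      unfolding alphabet_def by blast
  qed
qed

section \<open>Blocks of the hom tree-shift of a Markov shift\<close>

lemma finite_Delta: "finite (Delta d n)"
proof -
  have "Delta d n = {xs. set xs \<subseteq> {0..<d} \<and> length xs \<le> n}"
    by (auto simp: Delta_def)
  then show ?thesis
    by (simp add: finite_lists_length_le)
qed

lemma Delta_Suc:
  "Delta d (Suc n) = insert [] ((\<lambda>(i, w). i # w) ` ({0..<d} \<times> Delta d n))"
proof (intro set_eqI)
  fix w
  show "w \<in> Delta d (Suc n) \<longleftrightarrow> w \<in> insert [] ((\<lambda>(i, w). i # w) ` ({0..<d} \<times> Delta d n))"
    by (cases w) (auto simp: Delta_def)
qed

lemma card_Delta_0: "card (Delta d 0) = 1"
proof -
  have "Delta d 0 = {[]}"
    by (auto simp: Delta_def)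
  then show ?thesis
    by simp
qed

lemma card_Delta_Suc: "card (Delta d (Suc n)) = d * card (Delta d n) + 1"
proof -
  have "card (Delta d (Suc n)) = Suc (card ((\<lambda>(i, w). i # w) ` ({0..<d} \<times> Delta d n)))"
    unfolding Delta_Suc by (rule card_insert_disjoint) (auto simp: finite_Delta)
  also have "card ((\<lambda>(i, w). i # w) ` ({0..<d} \<times> Delta d n)) = card ({0..<d} \<times> Delta d n)"
    by (rule card_image) (auto simp: inj_on_def)
  finally show ?thesis
    by (simp add: card_cartesian_product)
qed

definition markov_blocks ::
  "nat \<Rightarrow> nat \<Rightarrow> 'a set \<Rightarrow> ('a \<Rightarrow> 'a \<Rightarrow> bool) \<Rightarrow> (nat list \<Rightarrow> 'a) set" where
  "markov_blocks d n A E =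
     {u \<in> Delta d n \<rightarrow>\<^sub>E A. \<forall>w a. w @ [a] \<in> Delta d n \<longrightarrow> E (u w) (u (w @ [a]))}"

lemma finite_markov_blocks:
  assumes "finite A"
  shows "finite (markov_blocks d n A E)"
  by (rule finite_subset[OF _ finite_PiE[OF finite_Delta[of d n], of "\<lambda>_. A"]])
    (auto simp: markov_blocks_def assms)

lemma card_markov_blocks_le:
  assumes "finite A"
  shows "card (markov_blocks d n A E) \<le> card A ^ card (Delta d n)"
proof -
  have "card (markov_blocks d n A E) \<le> card (Delta d n \<rightarrow>\<^sub>E A)"
    by (rule card_mono) (auto simp: markov_blocks_def assms finite_Delta intro!: finite_PiE)
  then show ?thesis
    by (simp add: card_PiE finite_Delta)
qed

lemma chain_through_edge:
  assumes "w @ [a] \<in> tree_nodes d"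
  obtains s where "chain d s" "s (length w) = w" "s (Suc (length w)) = w @ [a]"
proof
  let ?v = "w @ [a]"
  define s where "s = (\<lambda>i. take i ?v @ replicate (i - length ?v) 0)"
  have d: "0 < d"
    using assms by auto
  have "\<exists>b<d. s (Suc i) = s i @ [b]" for i
  proof (cases "i < length ?v")
    case True
    then have "?v ! i < d"
      using assms by (metis atLeastLessThan_iff in_listsD nth_mem)
    moreover have "s (Suc i) = s i @ [?v ! i]"
      using True by (simp add: s_def take_Suc_conv_app_nth del: take_append)
    ultimately show ?thesis
      by blast
  next
    case False
    then obtain k where "i = length ?v + k"
      using le_Suc_ex not_less by blast
    then have "s (Suc i) = s i @ [0]"
      by (simp add: s_def replicate_append_same flip: replicate_Suc)
    then show ?thesis
      using d by blast
  qed
  then show "chain d s"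
    by (simp add: chain_def s_def)
  show "s (length w) = w" "s (Suc (length w)) = ?v"
    by (simp_all add: s_def)
qed

lemma hom_tree_shift_edge:
  assumes "t \<in> hom_tree_shift d (markov_shift A E)" "w @ [a] \<in> tree_nodes d"
  shows "E (t w) (t (w @ [a]))"
proof -
  obtain s where "chain d s" "s (length w) = w" "s (Suc (length w)) = w @ [a]"
    using chain_through_edge[OF assms(2)] .
  moreover from this have "(\<lambda>i. t (s i)) \<in> markov_shift A E"
    using assms(1) by (auto simp: hom_tree_shift_def)
  ultimately show ?thesis
    unfolding markov_shift_def by (metis (mono_tags, lifting) mem_Collect_eq)
qed

lemma chain_tree_nodes:
  assumes "chain d s"
  shows "s i \<in> tree_nodes d"
proof (induction i)
  case 0
  then show ?case
    using assms by (simp add: chain_def)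
next
  case (Suc i)
  obtain a where "a < d" "s (Suc i) = s i @ [a]"
    using assms by (auto simp: chain_def)
  then show ?case
    using Suc by simp
qed

lemma hom_tree_shift_markovI:
  assumes serial: "\<And>a. a \<in> A \<Longrightarrow> \<exists>b\<in>A. E a b"
    and t: "t \<in> tree_nodes d \<rightarrow>\<^sub>E A"
    and edge: "\<And>w a. w @ [a] \<in> tree_nodes d \<Longrightarrow> E (t w) (t (w @ [a]))"
  shows "t \<in> hom_tree_shift d (markov_shift A E)"
proof -
  have "(\<lambda>i. t (s i)) \<in> markov_shift A E" if s: "chain d s" for s
  proof -
    have "t (s i) \<in> A" for i
      using t chain_tree_nodes[OF s, of i] by (rule PiE_mem)
    moreover have "E (t (s i)) (t (s (Suc i)))" for i
    proof -
      obtain a where "s (Suc i) = s i @ [a]"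
        using s by (auto simp: chain_def)
      then show ?thesis
        using edge[of "s i" a] chain_tree_nodes[OF s, of "Suc i"] by simp
    qed
    ultimately show ?thesis
      by (simp add: markov_shift_def)
  qed
  then show ?thesis
    using t by (simp add: hom_tree_shift_def alphabet_markov_shift[OF serial])
qed

text \<open>Choosing one allowed successor \<open>f a\<close> of every symbol \<open>a\<close>, a labeling of \<open>\<Delta>\<^sub>n\<close> with allowed
  transitions extends to the whole tree: below a node of depth \<open>n\<close>, iterate \<open>f\<close>.\<close>

lemma tree_blocks_markov_shift:
  assumes serial: "\<And>a. a \<in> A \<Longrightarrow> \<exists>b\<in>A. E a b"
  shows "tree_blocks d n (hom_tree_shift d (markov_shift A E)) = markov_blocks d n A E"
proof (intro equalityI subsetI)
  fix u assume "u \<in> tree_blocks d n (hom_tree_shift d (markov_shift A E))"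
  then obtain t s where u: "u \<in> extensional (Delta d n)"
    and t: "t \<in> hom_tree_shift d (markov_shift A E)"
    and s: "s \<in> tree_nodes d" and ts: "\<And>w. w \<in> Delta d n \<Longrightarrow> t (s @ w) = u w"
    unfolding tree_blocks_def appears_in_def by blast
  have t_mem: "t v \<in> A" if "v \<in> tree_nodes d" for v
    using t that by (auto simp: hom_tree_shift_def alphabet_markov_shift[OF serial])
  have "u w \<in> A" if "w \<in> Delta d n" for w
  proof -
    have "s @ w \<in> tree_nodes d"
      using s that by (simp add: Delta_def)
    then show ?thesis
      using t_mem ts[OF that] by metis
  qed
  moreover have "E (u w) (u (w @ [a]))" if wa: "w @ [a] \<in> Delta d n" for w a
  proof -
    have w: "w \<in> Delta d n"
      using wa by (simp add: Delta_def)
    have "(s @ w) @ [a] \<in> tree_nodes d"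
      using s wa by (simp add: Delta_def)
    from hom_tree_shift_edge[OF t this] show ?thesis
      using ts[OF w] ts[OF wa] by simp
  qed
  ultimately show "u \<in> markov_blocks d n A E"
    using u by (auto simp: markov_blocks_def PiE_def)
next
  fix u assume u: "u \<in> markov_blocks d n A E"
  obtain f where f: "\<And>a. a \<in> A \<Longrightarrow> f a \<in> A \<and> E a (f a)"
    using serial by metis
  define t where "t = (\<lambda>w\<in>tree_nodes d. (f ^^ (length w - n)) (u (take n w)))"
  have iter: "(f ^^ i) a \<in> A" if "a \<in> A" for a i
    using that by (induction i) (auto simp: f)
  have u_mem: "u (take n w) \<in> A" if "w \<in> tree_nodes d" for w
  proof -
    have "take n w \<in> Delta d n"
      using that by (auto simp: Delta_def dest: in_set_takeD)
    then show ?thesis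
      using u by (auto simp: markov_blocks_def)
  qed
  have "t \<in> hom_tree_shift d (markov_shift A E)"
  proof (rule hom_tree_shift_markovI[OF serial])
    show "t \<in> tree_nodes d \<rightarrow>\<^sub>E A"
      using u_mem iter by (auto simp: t_def)
  next
    fix w a assume wa: "w @ [a] \<in> tree_nodes d"
    then have w: "w \<in> tree_nodes d"
      by simp
    show "E (t w) (t (w @ [a]))"
    proof (cases "length w < n")
      case True
      then have "w @ [a] \<in> Delta d n"
        using wa by (simp add: Delta_def)
      moreover have "t w = u w" "t (w @ [a]) = u (w @ [a])"
        using True w wa by (simp_all add: t_def)
      ultimately show ?thesis
        using u by (simp add: markov_blocks_def)
    next
      case False
      then have "t (w @ [a]) = f (t w)"
        using w wa by (simp add: t_def Suc_diff_le)
      moreover have "t w \<in> A"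
        using w u_mem iter by (simp add: t_def)
      ultimately show ?thesis
        using f by simp
    qed
  qed auto
  moreover have "appears_in d n u t"
    unfolding appears_in_def by (rule bexI[of _ "[]"]) (auto simp: t_def Delta_def)
  moreover have "u \<in> extensional (Delta d n)"
    using u by (auto simp: markov_blocks_def PiE_def)
  ultimately show "u \<in> tree_blocks d n (hom_tree_shift d (markov_shift A E))"
    by (auto simp: tree_blocks_def)
qed

text \<open>Cutting a block at its root leaves \<open>d\<close> blocks of smaller height, and the only constraint on
  them is that their roots may follow the given root symbol.\<close>

lemma card_markov_blocks_root:
  assumes "a \<in> A"
  shows "card {u \<in> markov_blocks d (Suc n) A E. u [] = a} =
    card {v \<in> markov_blocks d n A E. E a (v [])} ^ d"
proof -
  let ?L = "{u \<in> markov_blocks d (Suc n) A E. u [] = a}"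
  let ?V = "{v \<in> markov_blocks d n A E. E a (v [])}"
  define cut where "cut = (\<lambda>u :: nat list \<Rightarrow> 'a. \<lambda>i\<in>{0..<d}. \<lambda>w\<in>Delta d n. u (i # w))"
  define graft where "graft = (\<lambda>v :: nat \<Rightarrow> nat list \<Rightarrow> 'a. \<lambda>w\<in>Delta d (Suc n).
    case w of [] \<Rightarrow> a | i # w' \<Rightarrow> v i w')"
  have Nil: "[] \<in> Delta d m" for m
    by (simp add: Delta_def)
  have Cons: "i # w \<in> Delta d (Suc m) \<longleftrightarrow> i < d \<and> w \<in> Delta d m" for i w m
    by (auto simp: Delta_def)
  have prefix: "w \<in> Delta d m" if "w @ [b] \<in> Delta d m" for w b m
    using that by (simp add: Delta_def)
  have "bij_betw cut ?L ({0..<d} \<rightarrow>\<^sub>E ?V)"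
  proof (rule bij_betw_byWitness[where f' = graft])
    show "\<forall>u\<in>?L. graft (cut u) = u"
    proof (intro ballI ext)
      fix u w assume u: "u \<in> ?L"
      show "graft (cut u) w = u w"
      proof (cases "w \<in> Delta d (Suc n)")
        case True
        then show ?thesis
          using u by (cases w) (auto simp: graft_def cut_def Cons)
      next
        case False
        then show ?thesis
          using u by (auto simp: graft_def markov_blocks_def)
      qed
    qed
    show "\<forall>v\<in>{0..<d} \<rightarrow>\<^sub>E ?V. cut (graft v) = v"
    proof (intro ballI ext)
      fix v i w assume v: "v \<in> {0..<d} \<rightarrow>\<^sub>E ?V"
      show "cut (graft v) i w = v i w"
      proof (cases "i < d")
        case True
        then have "v i \<in> markov_blocks d n A E"
          using v by auto
        then show ?thesis
          using True by (auto simp: graft_def cut_def Cons markov_blocks_def)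
      next
        case False
        then show ?thesis
          using v by (auto simp: cut_def)
      qed
    qed
    show "cut ` ?L \<subseteq> {0..<d} \<rightarrow>\<^sub>E ?V"
    proof (intro image_subsetI)
      fix u assume u: "u \<in> ?L"
      then have edge: "E (u w) (u (w @ [b]))" if "w @ [b] \<in> Delta d (Suc n)" for w b
        using that by (simp add: markov_blocks_def)
      have "cut u i \<in> ?V" if i: "i < d" for i
      proof -
        have "cut u i \<in> Delta d n \<rightarrow>\<^sub>E A"
          using u i by (auto simp: cut_def markov_blocks_def Cons)
        moreover have "E (cut u i w) (cut u i (w @ [b]))" if wb: "w @ [b] \<in> Delta d n" for w b
          using edge[of "i # w" b] i wb prefix[OF wb] by (simp add: cut_def Cons)
        moreover have "E a (cut u i [])"
          using edge[of "[]" i] u i by (simp add: cut_def Cons Nil)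
        ultimately show ?thesis
          by (simp add: markov_blocks_def)
      qed
      then show "cut u \<in> {0..<d} \<rightarrow>\<^sub>E ?V"
        by (auto simp: cut_def)
    qed
    show "graft ` ({0..<d} \<rightarrow>\<^sub>E ?V) \<subseteq> ?L"
    proof (intro image_subsetI)
      fix v assume v: "v \<in> {0..<d} \<rightarrow>\<^sub>E ?V"
      have vi: "v i \<in> markov_blocks d n A E" "E a (v i [])" if "i < d" for i
        using v that by auto
      have "graft v w \<in> A" if "w \<in> Delta d (Suc n)" for w
      proof (cases w)
        case Nil
        then show ?thesis
          using that assms by (simp add: graft_def)
      next
        case (Cons i w')
        then have "i < d" "w' \<in> Delta d n"
          using that \<open>\<And>i w m. i # w \<in> Delta d (Suc m) \<longleftrightarrow> i < d \<and> w \<in> Delta d m\<close> by auto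
        then show ?thesis
          using that Cons vi(1)[of i] by (auto simp: graft_def markov_blocks_def)
      qed
      moreover have "E (graft v w) (graft v (w @ [b]))" if wb: "w @ [b] \<in> Delta d (Suc n)" for w b
      proof (cases w)
        case Nil
        then have "b < d"
          using wb by (simp add: Cons)
        then show ?thesis
          using Nil wb prefix[OF wb] vi(2) by (simp add: graft_def)
      next
        case (Cons i w')
        then have "i < d" "w' @ [b] \<in> Delta d n"
          using wb \<open>\<And>i w m. i # w \<in> Delta d (Suc m) \<longleftrightarrow> i < d \<and> w \<in> Delta d m\<close> by auto
        then show ?thesis
          using Cons wb prefix[OF wb] vi(1)[of i] by (simp add: graft_def markov_blocks_def)
      qed
      moreover have "graft v \<in> extensional (Delta d (Suc n))" "graft v [] = a"
        by (simp_all add: graft_def Nil)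
      ultimately show "graft v \<in> ?L"
        by (auto simp: markov_blocks_def PiE_def)
    qed
  qed
  then have "card ?L = card ({0..<d} \<rightarrow>\<^sub>E ?V)"
    by (rule bij_betw_same_card)
  also have "\<dots> = card ?V ^ d"
    by (simp add: card_PiE)
  finally show ?thesis .
qed

section \<open>Growth rates of recursively bounded sequences\<close>

lemma power_mean_two:
  fixes x y :: real
  assumes "0 \<le> x" "0 \<le> y"
  shows "2 * ((x + y) / 2) ^ n \<le> x ^ n + y ^ n"
proof (induction n)
  case 0
  then show ?case
    by simp
next
  case (Suc n)
  have "0 \<le> (x ^ n - y ^ n) * (x - y)"
  proof (cases "x \<le> y")
    case True
    then show ?thesis
      using power_mono[of x y n] assms by (simp add: mult_nonpos_nonpos)
  next
    case False
    then show ?thesis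
      using power_mono[of y x n] assms by simp
  qed
  then have *: "(x + y) / 2 * (x ^ n + y ^ n) \<le> x ^ Suc n + y ^ Suc n"
    by (simp add: field_simps)
  have "2 * ((x + y) / 2) ^ Suc n = (x + y) / 2 * (2 * ((x + y) / 2) ^ n)"
    by simp
  also have "\<dots> \<le> (x + y) / 2 * (x ^ n + y ^ n)"
    using assms by (intro mult_left_mono Suc.IH) auto
  also note *
  finally show ?case .
qed

text \<open>Let \<open>c = 1 / (d - 1)\<close>, the constant with \<open>c d = 1 + c\<close>. In each step \<open>D\<^sub>n + c\<close> is multiplied
  by exactly \<open>d\<close>, and \<open>ln T\<^sub>n + c ln \<kappa>\<close> becomes at least \<open>d\<close> times as large. So the quotient of the
  latter by the former increases; its limit exists by the upper bound, agrees with that of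
  \<open>ln T\<^sub>n / D\<^sub>n\<close> because \<open>D\<^sub>n\<close> tends to infinity, and is at least the quotient at \<open>n = 0\<close>.\<close>

lemma growth_rate_bound:
  fixes d :: nat and D :: "nat \<Rightarrow> nat" and T :: "nat \<Rightarrow> real" and \<kappa> K :: real
  assumes d: "2 \<le> d" and D0: "D 0 = 1" and DSuc: "\<And>n. D (Suc n) = d * D n + 1"
    and T0: "0 < T 0" and \<kappa>: "1 \<le> \<kappa>" and TSuc: "\<And>n. \<kappa> * T n ^ d \<le> T (Suc n)"
    and upper: "\<And>n. T n \<le> K ^ D n" and K: "1 \<le> K"
  shows "\<exists>h. (\<lambda>n. ln (T n) / real (D n)) \<longlonglongrightarrow> h \<and> ((d - 1) * ln (T 0) + ln \<kappa>) / d \<le> h"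
proof -
  define c where "c = 1 / (real d - 1)"
  define q where "q = (\<lambda>n. (ln (T n) + c * ln \<kappa>) / (D n + c))"
  have c: "0 < c" and cd: "c * d = 1 + c"
    using d by (simp_all add: c_def field_simps)
  have Tpos: "0 < T n" for n
  proof (induction n)
    case (Suc n)
    then have "0 < \<kappa> * T n ^ d"
      using \<kappa> by simp
    then show ?case
      using TSuc[of n] by linarith
  qed (rule T0)
  have D_ge: "n < D n" for n
  proof (induction n)
    case (Suc n)
    have "D n \<le> d * D n"
      using d by simp
    then show ?case
      using Suc DSuc[of n] by linarith
  qed (simp add: D0)
  have Dpos: "0 < D n" for n
    using D_ge[of n] by simp
  have "q n \<le> q (Suc n)" for n
  proof -
    have "ln (\<kappa> * T n ^ d) \<le> ln (T (Suc n))"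
      using TSuc[of n] \<kappa> Tpos[of n] Tpos[of "Suc n"] by simp
    then have "ln \<kappa> + d * ln (T n) \<le> ln (T (Suc n))"
      using \<kappa> Tpos[of n] by (simp add: ln_mult ln_realpow)
    moreover have "d * (ln (T n) + c * ln \<kappa>) = d * ln (T n) + ln \<kappa> + c * ln \<kappa>"
    proof -
      have "d * (ln (T n) + c * ln \<kappa>) = d * ln (T n) + (c * d) * ln \<kappa>"
        by (simp add: algebra_simps)
      then show ?thesis
        unfolding cd by (simp add: algebra_simps)
    qed
    ultimately have num: "d * (ln (T n) + c * ln \<kappa>) \<le> ln (T (Suc n)) + c * ln \<kappa>"
      by linarith
    have den: "D (Suc n) + c = d * (D n + c)"
      using cd by (simp add: DSuc algebra_simps)
    have "q n = d * (ln (T n) + c * ln \<kappa>) / (d * (D n + c))"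
      using d by (simp add: q_def)
    also have "\<dots> \<le> (ln (T (Suc n)) + c * ln \<kappa>) / (d * (D n + c))"
      using num c by (intro divide_right_mono) auto
    also have "\<dots> = q (Suc n)"
      by (simp add: q_def den)
    finally show ?thesis .
  qed
  then have inc: "incseq q"
    by (rule incseq_SucI)
  have "q n \<le> ln K + ln \<kappa>" for n
  proof -
    have "ln (T n) \<le> ln (K ^ D n)"
      using upper[of n] Tpos[of n] K by simp
    then have "ln (T n) \<le> D n * ln K"
      using K by (simp add: ln_realpow)
    moreover have "0 \<le> c * ln K" "0 \<le> D n * ln \<kappa>"
      using c K \<kappa> by simp_all
    ultimately have "ln (T n) + c * ln \<kappa> \<le> (ln K + ln \<kappa>) * (D n + c)"
      by (simp add: algebra_simps)
    then show ?thesis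
      using c by (simp add: q_def pos_divide_le_eq)
  qed
  then obtain h where h: "q \<longlonglongrightarrow> h" and q_le: "\<forall>n. q n \<le> h"
    using incseq_convergent[OF inc] by metis
  have "filterlim (\<lambda>n. real (D n)) at_top sequentially"
  proof (rule filterlim_at_top_mono[OF filterlim_real_sequentially])
    show "\<forall>\<^sub>F n in sequentially. real n \<le> real (D n)"
      using D_ge by (simp add: less_imp_le)
  qed
  then have lim0: "(\<lambda>n. b / real (D n)) \<longlonglongrightarrow> 0" for b
    by (intro tendsto_divide_0[OF tendsto_const] filterlim_at_top_imp_at_infinity)
  have "(\<lambda>n. q n * (1 + c / D n) - c * ln \<kappa> / D n) \<longlonglongrightarrow> h * (1 + 0) - 0"
    by (intro tendsto_intros h lim0)
  moreover have "q n * (1 + c / D n) - c * ln \<kappa> / D n = ln (T n) / D n" for n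
  proof -
    have "1 + c / D n = (D n + c) / D n"
      using Dpos[of n] by (simp add: field_simps)
    moreover have "q n * (D n + c) = ln (T n) + c * ln \<kappa>"
      using c by (simp add: q_def add_nonneg_pos less_imp_neq[symmetric])
    ultimately have "q n * (1 + c / D n) = (ln (T n) + c * ln \<kappa>) / D n"
      by simp
    then show ?thesis
      by (simp add: add_divide_distrib)
  qed
  ultimately have "(\<lambda>n. ln (T n) / real (D n)) \<longlonglongrightarrow> h"
    by simp
  moreover have "((d - 1) * ln (T 0) + ln \<kappa>) / d = q 0"
    using d by (simp add: q_def c_def D0 of_nat_diff field_simps)
  ultimately show ?thesis
    using q_le by metis
qed

section \<open>The full shift and its partial splitting\<close>

lemma tree_entropy_full_shift:
  fixes A :: "'a set"
  assumes "finite A" "A \<noteq> {}"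
  shows "tree_entropy d (hom_tree_shift d (markov_shift A (\<lambda>_ _. True))) = ln (card A)"
proof -
  have "card (tree_blocks d n (hom_tree_shift d (markov_shift A (\<lambda>_ _. True)))) =
      card A ^ card (Delta d n)" for n
    using assms(2)
    by (subst tree_blocks_markov_shift) (auto simp: markov_blocks_def card_PiE finite_Delta)
  moreover have "[] \<in> Delta d n" for n
    by (simp add: Delta_def)
  then have "card (Delta d n) \<noteq> 0" for n
    using finite_Delta[of d n] by (metis card_0_eq empty_iff)
  moreover have "0 < card A"
    using assms by (simp add: card_gt_0_iff)
  ultimately have "(\<lambda>n. ln (real (card (tree_blocks d n
      (hom_tree_shift d (markov_shift A (\<lambda>_ _. True)))))) / real (card (Delta d n))) =
      (\<lambda>n. ln (card A))"
    by (simp add: ln_realpow)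
  then show ?thesis
    by (simp add: tree_entropy_def)
qed

text \<open>The symbols \<open>0\<close> and \<open>1\<close> stand for a \<open>0\<close> of the full shift followed by \<open>0\<close> and by \<open>1\<close>,
  respectively; \<open>2\<close> stands for a \<open>1\<close> of the full shift.\<close>

definition split_edge :: "nat \<Rightarrow> nat \<Rightarrow> bool" where
  "split_edge a b \<longleftrightarrow> (a = 0 \<longrightarrow> b \<noteq> 2) \<and> (a = 1 \<longrightarrow> b = 2)"

lemma split_edge_serial:
  assumes "a \<in> {0, 1, 2}"
  shows "\<exists>b\<in>{0, 1, 2}. split_edge a b"
  using assms by (auto simp: split_edge_def)

lemma conjugate_split_shift:
  "conjugate (markov_shift {0, 1 :: nat} (\<lambda>_ _. True)) (markov_shift {0, 1, 2} split_edge)"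
proof -
  let ?X = "markov_shift {0, 1 :: nat} (\<lambda>_ _. True)"
  let ?Y = "markov_shift {0, 1, 2} split_edge"
  define \<Phi> :: "nat list \<Rightarrow> nat" where "\<Phi> = (\<lambda>w. if w ! 0 = 1 then 2 else w ! 1)"
  define \<phi> where "\<phi> = (\<lambda>(x :: nat \<Rightarrow> nat) i. if x i = 1 then 2 else x (Suc i))"
  define \<psi> where "\<psi> = (\<lambda>(y :: nat \<Rightarrow> nat) i. if y i = 2 then 1 else 0 :: nat)"
  have X: "x \<in> ?X \<longleftrightarrow> (\<forall>i. x i = 0 \<or> x i = 1)" for x
    by (auto simp: markov_shift_def)
  have Y: "y \<in> ?Y \<longleftrightarrow> (\<forall>i. y i = 0 \<and> (y (Suc i) = 0 \<or> y (Suc i) = 1) \<or>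
      y i = 1 \<and> y (Suc i) = 2 \<or> y i = 2 \<and> y (Suc i) \<in> {0, 1, 2})" for y
  proof
    assume "y \<in> ?Y"
    then have y: "y i \<in> {0, 1, 2}" "split_edge (y i) (y (Suc i))" for i
      by (simp_all add: markov_shift_def)
    show "\<forall>i. y i = 0 \<and> (y (Suc i) = 0 \<or> y (Suc i) = 1) \<or>
        y i = 1 \<and> y (Suc i) = 2 \<or> y i = 2 \<and> y (Suc i) \<in> {0, 1, 2}"
    proof
      fix i
      show "y i = 0 \<and> (y (Suc i) = 0 \<or> y (Suc i) = 1) \<or>
          y i = 1 \<and> y (Suc i) = 2 \<or> y i = 2 \<and> y (Suc i) \<in> {0, 1, 2}"
        using y(1)[of i] y(1)[of "Suc i"] y(2)[of i] by (auto simp: split_edge_def)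
    qed
  next
    assume step: "\<forall>i. y i = 0 \<and> (y (Suc i) = 0 \<or> y (Suc i) = 1) \<or>
      y i = 1 \<and> y (Suc i) = 2 \<or> y i = 2 \<and> y (Suc i) \<in> {0, 1, 2}"
    have "y i \<in> {0, 1, 2} \<and> split_edge (y i) (y (Suc i))" for i
      using step[rule_format, of i] by (auto simp: split_edge_def)
    then show "y \<in> ?Y"
      by (simp add: markov_shift_def)
  qed
  have "bij_betw \<phi> ?X ?Y"
  proof (rule bij_betw_byWitness[where f' = \<psi>])
    show "\<forall>x\<in>?X. \<psi> (\<phi> x) = x"
    proof (intro ballI ext)
      fix x i assume "x \<in> ?X"
      then have "x i = 0 \<or> x i = 1" "x (Suc i) = 0 \<or> x (Suc i) = 1"
        by (simp_all only: X)
      then show "\<psi> (\<phi> x) i = x i"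
        by (auto simp: \<psi>_def \<phi>_def)
    qed
    show "\<forall>y\<in>?Y. \<phi> (\<psi> y) = y"
    proof (intro ballI ext)
      fix y i assume "y \<in> ?Y"
      then have "y i = 0 \<and> (y (Suc i) = 0 \<or> y (Suc i) = 1) \<or>
          y i = 1 \<and> y (Suc i) = 2 \<or> y i = 2 \<and> y (Suc i) \<in> {0, 1, 2}"
        by (simp only: Y)
      then show "\<phi> (\<psi> y) i = y i"
        by (auto simp: \<psi>_def \<phi>_def)
    qed
    show "\<phi> ` ?X \<subseteq> ?Y"
    proof (intro image_subsetI)
      fix x assume x: "x \<in> ?X"
      show "\<phi> x \<in> ?Y"
        unfolding Y
      proof
        fix i
        have "x i = 0 \<or> x i = 1" "x (Suc i) = 0 \<or> x (Suc i) = 1"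
          "x (Suc (Suc i)) = 0 \<or> x (Suc (Suc i)) = 1"
          using x by (simp_all only: X)
        then show "\<phi> x i = 0 \<and> (\<phi> x (Suc i) = 0 \<or> \<phi> x (Suc i) = 1) \<or>
            \<phi> x i = 1 \<and> \<phi> x (Suc i) = 2 \<or> \<phi> x i = 2 \<and> \<phi> x (Suc i) \<in> {0, 1, 2}"
          by (auto simp: \<phi>_def)
      qed
    qed
    show "\<psi> ` ?Y \<subseteq> ?X"
      unfolding image_subset_iff X by (simp add: \<psi>_def)
  qed
  moreover have "\<Phi> \<in> blocks 2 ?X \<rightarrow> alphabet ?Y"
  proof
    fix w assume "w \<in> blocks 2 ?X"
    then obtain x where "x \<in> ?X" and w: "w = map x [0..<2]"
      unfolding blocks_def by blast
    then have "x 1 = 0 \<or> x 1 = 1"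
      by (simp only: X)
    then have "\<Phi> w \<in> {0, 1, 2}"
      by (auto simp: w \<Phi>_def)
    moreover have "alphabet ?Y = {0, 1, 2}"
      by (rule alphabet_markov_shift) (rule split_edge_serial)
    ultimately show "\<Phi> w \<in> alphabet ?Y"
      by (simp only:)
  qed
  moreover have "\<forall>x\<in>?X. \<forall>i. \<phi> x i = \<Phi> (map x [i..<i + 2])"
    by (auto simp: \<phi>_def \<Phi>_def upt_rec)
  ultimately show ?thesis
    unfolding conjugate_def by (intro exI[of _ 2] exI[of _ \<Phi>] exI[of _ \<phi>]) simp
qed

lemma card_split_blocks_Suc:
  fixes d n :: nat
  defines "G \<equiv> \<lambda>m. markov_blocks d m {0, 1, 2} split_edge"
  defines "C \<equiv> {v \<in> G n. v [] = 2}"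
  shows "card (G (Suc n)) = (card (G n) - card C) ^ d + card C ^ d + card (G n) ^ d"
proof -
  have fin: "finite (G m)" for m
    by (simp add: G_def finite_markov_blocks)
  have root: "v [] \<in> {0, 1, 2}" if "v \<in> G m" for v m
  proof -
    have "[] \<in> Delta d m"
      by (simp add: Delta_def)
    with that show ?thesis
      unfolding G_def markov_blocks_def by blast
  qed
  have split: "G (Suc n) = {u \<in> G (Suc n). u [] = 0} \<union> {u \<in> G (Suc n). u [] = 1} \<union>
      {u \<in> G (Suc n). u [] = 2}"
    using root by auto
  have "card (G (Suc n)) = card {u \<in> G (Suc n). u [] = 0} + card {u \<in> G (Suc n). u [] = 1} +
      card {u \<in> G (Suc n). u [] = 2}"
    by (subst split, (subst card_Un_disjoint; use fin in auto)+)
  also have "card {u \<in> G (Suc n). u [] = 0} = card {v \<in> G n. split_edge 0 (v [])} ^ d"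
    unfolding G_def by (rule card_markov_blocks_root) simp
  also have "{v \<in> G n. split_edge 0 (v [])} = G n - C"
    by (auto simp: split_edge_def C_def)
  also have "card (G n - C) = card (G n) - card C"
    by (rule card_Diff_subset) (auto simp: C_def fin)
  also have "card {u \<in> G (Suc n). u [] = 1} = card {v \<in> G n. split_edge 1 (v [])} ^ d"
    unfolding G_def by (rule card_markov_blocks_root) simp
  also have "{v \<in> G n. split_edge 1 (v [])} = C"
    by (auto simp: split_edge_def C_def)
  also have "card {u \<in> G (Suc n). u [] = 2} = card {v \<in> G n. split_edge 2 (v [])} ^ d"
    unfolding G_def by (rule card_markov_blocks_root) simp
  also have "{v \<in> G n. split_edge 2 (v [])} = G n"
    by (auto simp: split_edge_def)
  finally show ?thesis .
qed

text \<open>Of the blocks of height \<open>n\<close>, those with root \<open>2\<close> may stand below \<open>1\<close> and the others below \<open>0\<close>;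
  whatever their proportion, the \<open>d\<close>-th powers of the two numbers add up to at least the value for
  an equal division.\<close>

lemma card_split_blocks_lower:
  fixes d n :: nat
  defines "G \<equiv> \<lambda>m. markov_blocks d m {0, 1, 2} split_edge"
  shows "(1 + 2 / 2 ^ d) * real (card (G n)) ^ d \<le> card (G (Suc n))"
proof -
  define C where "C = {v \<in> G n. v [] = 2}"
  let ?T = "real (card (G n))" and ?c = "real (card C)"
  have "finite (G n)"
    by (simp add: G_def finite_markov_blocks)
  then have "card C \<le> card (G n)"
    by (intro card_mono) (auto simp: C_def)
  moreover have "card (G (Suc n)) = (card (G n) - card C) ^ d + card C ^ d + card (G n) ^ d"
    unfolding G_def C_def by (rule card_split_blocks_Suc)
  ultimately have "real (card (G (Suc n))) = (?T - ?c) ^ d + ?c ^ d + ?T ^ d" and "?c \<le> ?T"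
    by (simp_all add: of_nat_diff)
  moreover have "2 * ((?T - ?c + ?c) / 2) ^ d \<le> (?T - ?c) ^ d + ?c ^ d"
    using \<open>?c \<le> ?T\<close> by (intro power_mean_two) auto
  ultimately show ?thesis
    by (simp add: power_divide algebra_simps)
qed

text \<open>Multiplied by \<open>d\<close> and exponentiated, the claim is \<open>2^d < 3^k (1 + 1 / 2^k) = 3^k + (3/2)^k\<close>
  with \<open>k = d - 1\<close>. The mean of \<open>3\<close> and \<open>3/2\<close> is \<open>9/4\<close>, which is greater than \<open>2\<close>.\<close>

lemma ln_two_less_split_bound:
  fixes d :: nat
  assumes d: "2 \<le> d"
  shows "ln 2 < ((d - 1) * ln 3 + ln (1 + 2 / 2 ^ d)) / d"
proof -
  define k where "k = d - 1"
  have dk: "d = Suc k" and k: "0 < k"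
    using d by (auto simp: k_def)
  have "(2 :: real) ^ k < (9 / 4) ^ k"
    using k by (intro power_strict_mono) auto
  moreover have "2 * ((3 + 3 / 2) / 2) ^ k \<le> 3 ^ k + (3 / 2 :: real) ^ k"
    by (rule power_mean_two) auto
  ultimately have "2 ^ d < 3 ^ k + (3 / 2 :: real) ^ k"
    by (simp add: dk)
  also have "\<dots> = 3 ^ k * (1 + 2 / 2 ^ d)"
    by (simp add: dk power_divide algebra_simps)
  finally have "ln (2 ^ d) < ln (3 ^ k * (1 + 2 / 2 ^ d) :: real)"
    by (subst ln_less_cancel_iff) (auto intro!: mult_pos_pos add_pos_pos)
  also have "\<dots> = ln (3 ^ k) + ln (1 + 2 / 2 ^ d :: real)"
    by (rule ln_mult_pos) (auto intro!: add_pos_pos)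
  finally have "d * ln 2 < k * ln 3 + ln (1 + 2 / 2 ^ d :: real)"
    by (simp add: ln_realpow)
  then show ?thesis
    using d by (simp add: k_def pos_less_divide_eq mult.commute)
qed

lemma tree_entropy_split_shift:
  fixes d :: nat
  assumes d: "2 \<le> d"
  shows "ln 2 < tree_entropy d (hom_tree_shift d (markov_shift {0, 1, 2} split_edge))"
proof -
  let ?G = "\<lambda>n. markov_blocks d n {0, 1, 2} split_edge"
  have T0: "card (?G 0) = 3"
  proof -
    have "?G 0 = Delta d 0 \<rightarrow>\<^sub>E {0, 1, 2}"
      by (auto simp: markov_blocks_def Delta_def)
    then show ?thesis
      by (simp add: card_PiE finite_Delta card_Delta_0)
  qed
  have "real (card (?G n)) \<le> 3 ^ card (Delta d n)" for n
  proof -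
    have "card (?G n) \<le> 3 ^ card (Delta d n)"
      using card_markov_blocks_le[of "{0, 1, 2}" d n split_edge] by (simp add: numeral_3_eq_3)
    then have "real (card (?G n)) \<le> real (3 ^ card (Delta d n))"
      by (rule of_nat_mono)
    then show ?thesis
      by simp
  qed
  then obtain h where h: "(\<lambda>n. ln (real (card (?G n))) / real (card (Delta d n))) \<longlonglongrightarrow> h"
    and le: "((d - 1) * ln (card (?G 0)) + ln (1 + 2 / 2 ^ d)) / d \<le> h"
    using growth_rate_bound[where D = "\<lambda>n. card (Delta d n)" and T = "\<lambda>n. real (card (?G n))"
        and \<kappa> = "1 + 2 / 2 ^ d" and K = 3, OF d card_Delta_0 card_Delta_Suc _ _
        card_split_blocks_lower] T0 by auto
  have "tree_blocks d n (hom_tree_shift d (markov_shift {0, 1, 2} split_edge)) = ?G n" for n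
    by (rule tree_blocks_markov_shift) (rule split_edge_serial)
  then have "tree_entropy d (hom_tree_shift d (markov_shift {0, 1, 2} split_edge)) = h"
    using limI[OF h] by (simp add: tree_entropy_def)
  then show ?thesis
    using ln_two_less_split_bound[OF d] le unfolding T0 by simp
qed

theorem proposition3p5:
  fixes d :: nat
  assumes "d \<ge> 2"
  shows "\<exists>(A :: nat set) (B :: nat set) X Y.
    is_SFT A X \<and> is_SFT B Y \<and> conjugate X Y \<and>
    tree_entropy d (hom_tree_shift d X) \<noteq> tree_entropy d (hom_tree_shift d Y)"
proof (intro exI conjI)
  show "is_SFT {0, 1 :: nat} (markov_shift {0, 1} (\<lambda>_ _. True))"
    and "is_SFT {0, 1, 2 :: nat} (markov_shift {0, 1, 2} split_edge)"
    by (simp_all add: is_SFT_markov_shift)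
  show "conjugate (markov_shift {0, 1 :: nat} (\<lambda>_ _. True)) (markov_shift {0, 1, 2} split_edge)"
    by (rule conjugate_split_shift)
  have "tree_entropy d (hom_tree_shift d (markov_shift {0, 1 :: nat} (\<lambda>_ _. True))) = ln 2"
    by (subst tree_entropy_full_shift) simp_all
  then show "tree_entropy d (hom_tree_shift d (markov_shift {0, 1 :: nat} (\<lambda>_ _. True))) \<noteq>
      tree_entropy d (hom_tree_shift d (markov_shift {0, 1, 2} split_edge))"
    using tree_entropy_split_shift[OF assms] by simp
qed

end
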